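(* Let $T$ be a downward directed rooted tree with root $r$. Let $(S_T)$ be the pebbling assignment on $T$ with two or three pebbles on $r$, exactly one pebble on each non-root vertex of non-zero valence, and any number of pebbles on each vertex of valence zero. Then $T\cong [S_T]$ as directed graphs.
   Context: The valence of a vertex is its out-degree. A downward directed rooted tree is an oriented graph whose underlying undirected graph is a tree, with a vertex $r$ (the root) such that every edge is directed away from $r$ (every vertex is reached from $r$ by a directed path). A pebbling assignment assigns a nonnegative integer number of pebbles to each vertex. A pebbling move along an edge $(v,w)$ (allowed when $v$ has at least two pebbles) removes two pebbles from $v$ and adds one pebble to $w$. The assignment graph $[S_T]$ is the directed graph whose vertices are all assignments obtainable from $(S_T)$ by finite sequences of pebbling moves (including $(S_T)$ itself), with a directed edge from $A$ to $B$ whenever $B$ is obtained from $A$ by a single pebbling move. *)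

theory Defs
  imports "Graph_Theory.Digraph_Isomorphism" "HOL-Library.Extended_Nat"
begin

locale oriented_graph = loopfree_digraph + nomulti_digraph +
  assumes no_antiparallel: "u \<rightarrow>\<^bsub>G\<^esub> v \<Longrightarrow> \<not> v \<rightarrow>\<^bsub>G\<^esub> u"

(* The library predicate "tree" only excludes directed cycles, so it is too weak here.
   The underlying undirected graph is represented by mk_symmetric G, where traversing
   an edge back and forth is a closed walk of length 2; undirected cycles are those of
   length at least 3. *)
definition underlying_tree :: "('a, 'b) pre_digraph \<Rightarrow> bool" where
  "underlying_tree G \<longleftrightarrow>
     Digraph_Component.connected G \<and>
     \<not> (\<exists>p. pre_digraph.cycle (with_proj (mk_symmetric G)) p \<and> 3 \<le> length p)"

(* Neither finiteness nor local finiteness is required. *)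
locale downward_rooted_tree = oriented_graph T
  for T :: "('a, 'b) pre_digraph" and r :: 'a +
  assumes underlying_tree: "underlying_tree T"
    and root_in_verts: "r \<in> verts T"
    and reachable_from_root: "v \<in> verts T \<Longrightarrow> r \<rightarrow>\<^sup>*\<^bsub>T\<^esub> v"

(* out_degree is a cardinality in nat, hence 0 for a vertex with infinitely many out-arcs;
   the valence of such a vertex is infinite. *)
definition valence :: "('a, 'b) pre_digraph \<Rightarrow> 'a \<Rightarrow> enat" where
  "valence G v = (if finite (out_arcs G v) then enat (out_degree G v) else \<infinity>)"

(* Values at points outside verts G carry no meaning: no move ever changes them. *)
type_synonym 'a assignment = "'a \<Rightarrow> nat"

definition pebbling_move_along ::
    "('a, 'b) pre_digraph \<Rightarrow> 'b \<Rightarrow> 'a assignment \<Rightarrow> 'a assignment \<Rightarrow> bool" where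
  "pebbling_move_along G e A B \<longleftrightarrow>
     2 \<le> A (tail G e) \<and>
     B = (\<lambda>x. A x - (if x = tail G e then 2 else 0) + (if x = head G e then 1 else 0))"

definition pebbling_move ::
    "('a, 'b) pre_digraph \<Rightarrow> 'a assignment \<Rightarrow> 'a assignment \<Rightarrow> bool" where
  "pebbling_move G A B \<longleftrightarrow> (\<exists>e \<in> arcs G. pebbling_move_along G e A B)"

definition assignment_graph ::
    "('a, 'b) pre_digraph \<Rightarrow> 'a assignment \<Rightarrow>
     ('a assignment, 'a assignment \<times> 'a assignment) pre_digraph" where
  "assignment_graph G S =
     \<lparr> verts = {A. (pebbling_move G)\<^sup>*\<^sup>* S A},
       arcs = {(A, B). (pebbling_move G)\<^sup>*\<^sup>* S A \<and> pebbling_move G A B},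
       tail = fst,
       head = snd \<rparr>"

end

theory Submission
  imports Defs
begin

text \<open>
  Along the directed path from the root to a vertex \<open>v\<close>, moves pass a single pebble downwards;
  they empty every inner vertex of the path other than the root, leave at most one pebble on the
  root and put one extra pebble on \<open>v\<close>. In the resulting assignment the only vertex of non-zero
  valence that can carry two pebbles is \<open>v\<close> itself, so the moves available there are exactly the
  arcs out of \<open>v\<close>. Hence \<open>v\<close> is mapped to this assignment by an isomorphism. Uniqueness of the
  path comes from the absence of undirected cycles.
\<close>

section \<open>Directed walks seen as undirected walks\<close>

context wf_digraph
begin

lemma pawalk_verts_map_arc_to_ends:
  "pawalk_verts u (map (arc_to_ends G) p) = awalk_verts u p"
  by (induction p arbitrary: u) (auto simp: arc_to_ends_def)

lemma awalk_mk_symmetric_map_arc_to_ends: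
  assumes "awalk u p v"
  shows "pre_digraph.awalk (with_proj (mk_symmetric G)) u (map (arc_to_ends G) p) v"
proof -
  interpret S: pair_wf_digraph "mk_symmetric G" ..
  show ?thesis
    using assms
    by (induction p arbitrary: u)
       (auto simp: awalk_simps S.awalk_simps arc_to_ends_def parcs_mk_symmetric)
qed

text \<open>Every arc is traversed backwards. Only the vertex set is recorded, which is enough to
  see that a vertex is avoided.\<close>

lemma awalk_mk_symmetric_reverse:
  assumes "awalk u p v"
  shows "\<exists>q. pre_digraph.awalk (with_proj (mk_symmetric G)) v q u \<and>
    set (pawalk_verts v q) = set (awalk_verts u p)"
proof -
  interpret S: pair_wf_digraph "mk_symmetric G" ..
  show ?thesis
    using assms
  proof (induction p arbitrary: u)
    case Nil
    then show ?case by (intro exI[of _ "[]"]) (auto simp: awalk_simps S.awalk_simps)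
  next
    case (Cons e p)
    then have e: "e \<in> arcs G" "u = tail G e" and p: "awalk (head G e) p v"
      by (auto simp: awalk_simps)
    from Cons.IH[OF p] obtain q where q: "S.awalk v q (head G e)"
      "set (pawalk_verts v q) = set (awalk_verts (head G e) p)"
      by (elim exE conjE)
    let ?a = "(head G e, tail G e)"
    have a: "S.awalk (head G e) [?a] u"
      using e by (auto simp: S.awalk_simps parcs_mk_symmetric)
    have "head G e \<in> set (awalk_verts (head G e) p)"
      using p by (rule hd_in_awalk_verts(1))
    with q a e have "set (pawalk_verts v (q @ [?a])) = set (awalk_verts u (e # p))"
      by (simp add: S.set_awalk_verts_append[OF q(1) a] insert_absorb)
    with q(1) a show ?case by (meson S.awalk_appendI)
  qed
qed

end

section \<open>Acyclicity and uniqueness of parents\<close>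

context downward_rooted_tree
begin

interpretation sym: pair_wf_digraph "mk_symmetric T" ..

lemma no_apath_closing_up:
  assumes p: "sym.apath u p v" "2 \<le> length p" and vu: "(v, u) \<in> parcs (mk_symmetric T)"
  shows False
proof -
  have "sym.cycle ((v, u) # p)"
    unfolding sym.cycle_def using p(1) vu
    \<comment> \<open>Started at \<open>v\<close>, the closed walk has the vertices of
      \<open>p\<close> after its first entry, so distinctness comes from the path.\<close>
    by (intro exI[of _ v]) (auto simp: sym.apath_def sym.awalk_simps)
  moreover have "3 \<le> length ((v, u) # p)" using p(2) by simp
  ultimately show False
    using underlying_tree unfolding underlying_tree_def by metis
qed

lemma acyclic: "\<not> x \<rightarrow>\<^sup>+\<^bsub>T\<^esub> x"
proof
  assume "x \<rightarrow>\<^sup>+\<^bsub>T\<^esub> x"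
  then obtain y where xy: "x \<rightarrow>\<^bsub>T\<^esub> y" and "(y, x) \<in> (arcs_ends T)\<^sup>*"
    using tranclD by metis
  then have yx: "y \<rightarrow>\<^sup>*\<^bsub>T\<^esub> x"
    by (simp add: reachable_conv'[OF adj_in_verts(2)])
  from yx obtain p where p: "apath y p x"
    unfolding reachable_apath by (elim exE)
  \<comment> \<open>Length 0 would make the arc from \<open>x\<close> to \<open>y\<close> a loop,
    length 1 would give an antiparallel arc.\<close>
  have "2 \<le> length p"
  proof (rule ccontr)
    assume "\<not> 2 \<le> length p"
    then consider "p = []" | e where "p = [e]"
      by (cases p; cases "tl p") auto
    then show False
    proof cases
      case 1
      with p xy show False by (auto simp: apath_simps dest: adj_not_same)
    next
      case 2
      with p have "y \<rightarrow>\<^bsub>T\<^esub> x" by (auto simp: apath_simps intro: in_arcs_imp_in_arcs_ends)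
      with xy no_antiparallel show False by blast
    qed
  qed
  moreover have "sym.apath y (map (arc_to_ends T) p) x"
    using p by (auto simp: sym.apath_def apath_def awalk_mk_symmetric_map_arc_to_ends pawalk_verts_map_arc_to_ends)
  moreover have "(x, y) \<in> parcs (mk_symmetric T)"
    using xy by (auto simp: parcs_mk_symmetric arcs_ends_conv)
  ultimately show False using no_apath_closing_up by force
qed

text \<open>Two distinct parents are joined through the root by an undirected walk avoiding
  \<open>w\<close>; shortened to a path and closed up through \<open>w\<close>, it is an undirected
  cycle.\<close>

lemma parent_unique:
  assumes "u1 \<rightarrow>\<^bsub>T\<^esub> w" "u2 \<rightarrow>\<^bsub>T\<^esub> w"
  shows "u1 = u2"
proof (rule ccontr)
  assume "u1 \<noteq> u2"
  have avoid: "\<exists>p. awalk r p u \<and> w \<notin> set (awalk_verts r p)" if u: "u \<rightarrow>\<^bsub>T\<^esub> w" for u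
  proof -
    from u obtain p where p: "awalk r p u"
      by (metis adj_in_verts(1) reachable_awalk reachable_from_root)
    \<comment> \<open>Otherwise \<open>w\<close> reaches \<open>u\<close>, and the arc from
      \<open>u\<close> to \<open>w\<close> closes a directed cycle.\<close>
    have "w \<notin> set (awalk_verts r p)"
      using awalk_verts_reachable_to[OF p] u acyclic by (metis reachable_reachable1_trans r_into_trancl)
    with p show ?thesis by blast
  qed
  from avoid[OF assms(1)]
  obtain p1 where p1: "sym.awalk u1 p1 r" "w \<notin> set (pawalk_verts u1 p1)"
    by (metis awalk_mk_symmetric_reverse)
  from avoid[OF assms(2)]
  obtain p2 where p2: "sym.awalk r p2 u2" "w \<notin> set (pawalk_verts r p2)"
    by (metis awalk_mk_symmetric_map_arc_to_ends pawalk_verts_map_arc_to_ends)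
  have walk: "sym.awalk u1 (p1 @ p2) u2" using p1 p2 by auto
  define p where "p = sym.awalk_to_apath (p1 @ p2)"
  have p: "sym.apath u1 p u2" unfolding p_def using walk by (rule sym.apath_awalk_to_apath)
  have "w \<notin> set (pawalk_verts u1 p)"
  proof -
    \<comment> \<open>Shortening uses only arcs of the walk, so it visits no new vertex.\<close>
    have "set p \<subseteq> set (p1 @ p2)"
      unfolding p_def using walk by (rule sym.awalk_to_apath_subset)
    then have "set (pawalk_verts u1 p) \<subseteq> set (pawalk_verts u1 (p1 @ p2))"
      unfolding sym.set_awalk_verts[OF walk] sym.set_awalk_verts[OF sym.awalkI_apath[OF p]]
      by (simp only: set_map) fast
    with p1 p2 show ?thesis
      unfolding sym.set_awalk_verts_append[OF p1(1) p2(1)] by fast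
  qed
  with p assms have "sym.apath w ((w, u1) # p) u2"
    by (auto simp: sym.apath_Cons_iff parcs_mk_symmetric arcs_ends_conv)
  moreover have "p \<noteq> []" using p \<open>u1 \<noteq> u2\<close> by (auto simp: sym.apath_Nil_iff)
  then have "2 \<le> length ((w, u1) # p)" by (cases p) auto
  moreover have "(u2, w) \<in> parcs (mk_symmetric T)"
    using assms by (auto simp: parcs_mk_symmetric arcs_ends_conv)
  ultimately show False by (rule no_apath_closing_up)
qed

text \<open>The last arc of a walk into \<open>w\<close> must come from its only parent
  \<open>u\<close>. Thus passing from \<open>u\<close> to \<open>w\<close> adds just
  \<open>u\<close> to the strict ancestors.\<close>

lemma reachable1_head_iff:
  assumes "u \<rightarrow>\<^bsub>T\<^esub> w"
  shows "x \<rightarrow>\<^sup>+\<^bsub>T\<^esub> w \<longleftrightarrow> x = u \<or> x \<rightarrow>\<^sup>+\<^bsub>T\<^esub> u"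
  using assms parent_unique by (metis r_into_trancl trancl.trancl_into_trancl tranclE)

lemma root_reachable1: "v \<in> verts T \<Longrightarrow> v \<noteq> r \<Longrightarrow> r \<rightarrow>\<^sup>+\<^bsub>T\<^esub> v"
  by (metis reachable_from_root reachable_neq_reachable1)

lemma not_reachable1_root: "\<not> x \<rightarrow>\<^sup>+\<^bsub>T\<^esub> r"
  by (metis acyclic reachable1_in_verts(1) root_reachable1 trancl_trans)

section \<open>The assignment attached to a vertex, and its moves\<close>

lemma valence_tail_neq_0:
  assumes "e \<in> arcs T"
  shows "valence T (tail T e) \<noteq> 0"
  using assms by (auto simp: valence_def out_degree_def out_arcs_def zero_enat_def)

text \<open>The path is encoded by the strict ancestors of \<open>v\<close>. Each of them gives up
  two pebbles, and each except the root has received one, hence the net losses 2 and 1.\<close>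

definition path_assignment :: "'a assignment \<Rightarrow> 'a \<Rightarrow> 'a assignment" where
  "path_assignment S v x =
     S x + (if x = v \<and> x \<noteq> r then 1 else 0)
         - (if x \<rightarrow>\<^sup>+\<^bsub>T\<^esub> v then if x = r then 2 else 1 else 0)"

lemma path_assignment_root: "path_assignment S r = S"
  by (simp add: fun_eq_iff path_assignment_def not_reachable1_root)

lemma inj_on_path_assignment: "inj_on (path_assignment S) (verts T)"
proof (rule inj_onI, rule ccontr)
  fix v w
  assume vw: "v \<in> verts T" "w \<in> verts T" "path_assignment S v = path_assignment S w" "v \<noteq> w"
  \<comment> \<open>A non-root vertex holds its extra pebble only in its own assignment; of two
    distinct vertices at least one is not the root.\<close>
  have *: "path_assignment S y x < path_assignment S x x" if "x \<noteq> y" "x \<noteq> r" for x y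
    using that by (simp add: path_assignment_def acyclic)
  show False
    using vw *[of v w] *[of w v] by (metis less_irrefl)
qed

context
  fixes S :: "'a assignment"
  assumes S_root: "S r = 2 \<or> S r = 3"
    and S_inner: "\<And>v. v \<in> verts T \<Longrightarrow> v \<noteq> r \<Longrightarrow> valence T v \<noteq> 0 \<Longrightarrow> S v = 1"
begin

lemma S_tail: "e \<in> arcs T \<Longrightarrow> tail T e \<noteq> r \<Longrightarrow> S (tail T e) = 1"
  by (simp add: S_inner valence_tail_neq_0)

lemma move_along_path_assignment_iff:
  assumes e: "e \<in> arcs T" and v: "v \<in> verts T"
  shows "pebbling_move_along T e (path_assignment S v) B \<longleftrightarrow>
    tail T e = v \<and> B = path_assignment S (head T e)"
proof (cases "tail T e = v")
  case True
  let ?w = "head T e"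
  have adj: "v \<rightarrow>\<^bsub>T\<^esub> ?w" using e True by (auto intro: in_arcs_imp_in_arcs_ends)
  have "?w \<noteq> r" "?w \<noteq> v" "\<not> ?w \<rightarrow>\<^sup>+\<^bsub>T\<^esub> v"
    using adj not_reachable1_root acyclic by (metis r_into_trancl trancl_trans)+
  \<comment> \<open>The root starts with two or three pebbles; any other tail has one of its own and
    the one passed down.\<close>
  moreover have "2 \<le> path_assignment S v v"
    using S_root S_tail[OF e] True by (simp add: path_assignment_def acyclic) linarith
  moreover have "path_assignment S v x - (if x = v then 2 else 0) + (if x = ?w then 1 else 0)
      = path_assignment S ?w x" for x
    using calculation(1-3) by (simp add: path_assignment_def acyclic reachable1_head_iff[OF adj] numeral_2_eq_2)
  ultimately show ?thesis
    using True by (simp add: pebbling_move_along_def fun_eq_iff)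
next
  case False
  \<comment> \<open>If the tail is the root, it is a strict ancestor of \<open>v\<close> and has
    lost two of at most three pebbles; any other tail has at most its initial one.\<close>
  then have "path_assignment S v (tail T e) < 2"
    using S_root S_tail[OF e] root_reachable1[OF v]
    by (cases "tail T e = r") (auto simp: path_assignment_def)
  with False show ?thesis by (auto simp: pebbling_move_along_def)
qed

lemma move_path_assignment_iff:
  assumes "v \<in> verts T"
  shows "pebbling_move T (path_assignment S v) B \<longleftrightarrow>
    (\<exists>e\<in>arcs T. tail T e = v \<and> B = path_assignment S (head T e))"
  using assms by (auto simp: pebbling_move_def move_along_path_assignment_iff)

lemma obtainable_assignments: "{A. (pebbling_move T)\<^sup>*\<^sup>* S A} = path_assignment S ` verts T"
proof (intro equalityI subsetI)
  fix A
  assume "A \<in> {A. (pebbling_move T)\<^sup>*\<^sup>* S A}"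
  then have "(pebbling_move T)\<^sup>*\<^sup>* S A" by simp
  then show "A \<in> path_assignment S ` verts T"
  proof induction
    case base
    then show ?case by (metis image_eqI path_assignment_root root_in_verts)
  next
    case (step A B)
    then show ?case by (auto simp: move_path_assignment_iff)
  qed
next
  fix A
  assume "A \<in> path_assignment S ` verts T"
  then obtain v where v: "v \<in> verts T" and A: "A = path_assignment S v" by blast
  \<comment> \<open>Each arc of the directed path from the root is realised by one move.\<close>
  from reachable_from_root[OF v] have "(pebbling_move T)\<^sup>*\<^sup>* S (path_assignment S v)"
  proof (induction rule: reachable_induct)
    case base
    then show ?case by (simp add: path_assignment_root)
  next
    case (step u w)
    then have "pebbling_move T (path_assignment S u) (path_assignment S w)"
      by (auto simp: move_path_assignment_iff adj_in_verts arcs_ends_conv)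
    with step show ?case by simp
  qed
  with A show "A \<in> {A. (pebbling_move T)\<^sup>*\<^sup>* S A}" by simp
qed

lemma digraph_iso_assignment_graph: "digraph_iso T (assignment_graph T S)"
proof -
  let ?f = "path_assignment S"
  let ?g = "\<lambda>e. (?f (tail T e), ?f (head T e))"
  let ?h = "\<lparr>iso_verts = ?f, iso_arcs = ?g, iso_head = snd, iso_tail = fst\<rparr>"
  have "inj_on ?g (arcs T)"
  proof (rule inj_onI)
    fix e e'
    assume "e \<in> arcs T" "e' \<in> arcs T" "?g e = ?g e'"
    then show "e = e'"
      using inj_on_path_assignment[of S]
      \<comment> \<open>Injectivity on vertices recovers both ends of the arc, and the ends
        determine the arc.\<close>
      by (intro no_multi_arcs) (auto simp: arc_to_ends_def dest: inj_onD)
  qed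
  then have "digraph_isomorphism ?h"
    by (auto simp: digraph_isomorphism_def inj_on_path_assignment wf_digraph_axioms)
  \<comment> \<open>Every obtainable assignment belongs to some vertex, and its moves are the arcs
    out of that vertex.\<close>
  moreover have "{(A, B). (pebbling_move T)\<^sup>*\<^sup>* S A \<and> pebbling_move T A B} = ?g ` arcs T"
    using obtainable_assignments by (fastforce simp: move_path_assignment_iff set_eq_iff)
  then have "assignment_graph T S = app_iso ?h T"
    by (simp add: assignment_graph_def app_iso_def obtainable_assignments)
  ultimately show ?thesis
    unfolding digraph_iso_def by blast
qed

end

end

theorem theorem5p1:
  fixes T :: "('a, 'b) pre_digraph" and r :: 'a and S :: "'a assignment"
  assumes "downward_rooted_tree T r"
    and "S r = 2 \<or> S r = 3"
    and "\<And>v. v \<in> verts T \<Longrightarrow> v \<noteq> r \<Longrightarrow> valence T v \<noteq> 0 \<Longrightarrow> S v = 1"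
  shows "digraph_iso T (assignment_graph T S)"
  using assms by (rule downward_rooted_tree.digraph_iso_assignment_graph)

end
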